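(* Let $n=1$ and let $u\in H^2_{loc}(\mathbb{R})$ be defined by $u(x)=\frac12x^2$ for $x>0$ and $u(x)=0$ for $x\le 0$. Then $u$ is not a global minimizer of $\tilde{\mathcal{F}}$. More precisely, there exists $v\in H^2((-1,1))$ such that $v-u\in H^2_0((-1,1))$ and $\tilde{\mathcal{F}}(v,(-1,1))<\tilde{\mathcal{F}}(u,(-1,1))$.
   Context: For $\Omega\subset\mathbb{R}^n$ open and bounded and $u\in H^2(\Omega)$, the one-sided biharmonic Alt-Caffarelli functional is $\tilde{\mathcal{F}}(u,\Omega):=\int_\Omega(\Delta u)^2\,\mathrm{d}x+|\{x\in\Omega:u(x)>0\}|$, where $|\cdot|$ is Lebesgue measure (for $n=1$, $\Delta u=u''$). A function $u\in H^2_{loc}(\mathbb{R}^n)$ is a global minimizer of $\tilde{\mathcal{F}}$ if for all bounded open sets $\Omega\subset\mathbb{R}^n$ and all $v\in H^2(\Omega)$ with $v-u\in H^2_0(\Omega)$ one has $\tilde{\mathcal{F}}(u,\Omega)\le\tilde{\mathcal{F}}(v,\Omega)$. Here $H^2_0(\Omega)$ is the closure of $C_0^\infty(\Omega)$ in $H^2(\Omega)$. *)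

theory Defs
  imports "HOL-Analysis.Analysis"
begin

definition partial_deriv :: "'a::euclidean_space \<Rightarrow> ('a \<Rightarrow> real) \<Rightarrow> 'a \<Rightarrow> real" where
  "partial_deriv i f = (\<lambda>x. frechet_derivative f (at x) i)"

text \<open>A derivative of order \<open>k\<close> is indexed by a list of \<open>k\<close> coordinate directions
  (elements of \<open>Basis\<close>) in place of a multi-index.\<close>

primrec partial_derivs :: "'a::euclidean_space list \<Rightarrow> ('a \<Rightarrow> real) \<Rightarrow> 'a \<Rightarrow> real" where
  "partial_derivs [] f = f"
| "partial_derivs (i # is) f = partial_deriv i (partial_derivs is f)"

definition smooth :: "('a::euclidean_space \<Rightarrow> real) \<Rightarrow> bool" where
  "smooth f \<longleftrightarrow> (\<forall>is \<in> lists Basis. \<forall>x. partial_derivs is f differentiable (at x))"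

definition test_functions :: "'a::euclidean_space set \<Rightarrow> ('a \<Rightarrow> real) set" where
  "test_functions \<Omega> =
     {\<phi>. smooth \<phi> \<and> compact (closure {x. \<phi> x \<noteq> 0}) \<and> closure {x. \<phi> x \<noteq> 0} \<subseteq> \<Omega>}"

text \<open>Function classes on \<open>\<Omega>\<close> consist of representatives that are total functions;
  their values outside \<open>\<Omega>\<close> are irrelevant.\<close>

definition locally_integrable :: "'a::euclidean_space set \<Rightarrow> ('a \<Rightarrow> real) \<Rightarrow> bool" where
  "locally_integrable \<Omega> f \<longleftrightarrow> (\<forall>K. compact K \<and> K \<subseteq> \<Omega> \<longrightarrow> integrable (lebesgue_on K) f)"

definition has_weak_deriv ::
  "'a::euclidean_space set \<Rightarrow> 'a list \<Rightarrow> ('a \<Rightarrow> real) \<Rightarrow> ('a \<Rightarrow> real) \<Rightarrow> bool" where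
  "has_weak_deriv \<Omega> is u g \<longleftrightarrow>
     locally_integrable \<Omega> u \<and> locally_integrable \<Omega> g \<and>
     (\<forall>\<phi> \<in> test_functions \<Omega>.
        (LINT x|lebesgue_on \<Omega>. u x * partial_derivs is \<phi> x)
        = (- 1) ^ length is * (LINT x|lebesgue_on \<Omega>. g x * \<phi> x))"

text \<open>On open \<open>\<Omega>\<close>, weak derivatives are unique up to null sets, so the choice below does not
  affect any of the integrals in which it is used.\<close>

definition weak_deriv ::
  "'a::euclidean_space set \<Rightarrow> 'a list \<Rightarrow> ('a \<Rightarrow> real) \<Rightarrow> 'a \<Rightarrow> real" where
  "weak_deriv \<Omega> is u = (SOME g. has_weak_deriv \<Omega> is u g)"

definition L2 :: "'a::euclidean_space set \<Rightarrow> ('a \<Rightarrow> real) set" where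
  "L2 \<Omega> = {f. f \<in> borel_measurable (lebesgue_on \<Omega>) \<and> integrable (lebesgue_on \<Omega>) (\<lambda>x. (f x)\<^sup>2)}"

definition H2 :: "'a::euclidean_space set \<Rightarrow> ('a \<Rightarrow> real) set" where
  "H2 \<Omega> = {u. u \<in> L2 \<Omega> \<and>
     (\<forall>i\<in>Basis. \<exists>g\<in>L2 \<Omega>. has_weak_deriv \<Omega> [i] u g) \<and>
     (\<forall>i\<in>Basis. \<forall>j\<in>Basis. \<exists>g\<in>L2 \<Omega>. has_weak_deriv \<Omega> [i, j] u g)}"

definition H2_loc :: "('a::euclidean_space \<Rightarrow> real) set" where
  "H2_loc = {u. \<forall>\<Omega>. open \<Omega> \<and> bounded \<Omega> \<longrightarrow> u \<in> H2 \<Omega>}"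

definition H2_norm :: "'a::euclidean_space set \<Rightarrow> ('a \<Rightarrow> real) \<Rightarrow> real" where
  "H2_norm \<Omega> u = sqrt (
     (LINT x|lebesgue_on \<Omega>. (u x)\<^sup>2)
     + (\<Sum>i\<in>Basis. LINT x|lebesgue_on \<Omega>. (weak_deriv \<Omega> [i] u x)\<^sup>2)
     + (\<Sum>i\<in>Basis. \<Sum>j\<in>Basis. LINT x|lebesgue_on \<Omega>. (weak_deriv \<Omega> [i, j] u x)\<^sup>2))"

definition H2_0 :: "'a::euclidean_space set \<Rightarrow> ('a \<Rightarrow> real) set" where
  "H2_0 \<Omega> = {w \<in> H2 \<Omega>. \<forall>\<epsilon>>0. \<exists>\<phi>\<in>test_functions \<Omega>. H2_norm \<Omega> (\<lambda>x. w x - \<phi> x) < \<epsilon>}"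

definition weak_laplacian :: "'a::euclidean_space set \<Rightarrow> ('a \<Rightarrow> real) \<Rightarrow> 'a \<Rightarrow> real" where
  "weak_laplacian \<Omega> u = (\<lambda>x. \<Sum>i\<in>Basis. weak_deriv \<Omega> [i, i] u x)"

definition AC_functional :: "('a::euclidean_space \<Rightarrow> real) \<Rightarrow> 'a set \<Rightarrow> real" where
  "AC_functional u \<Omega> =
     (LINT x|lebesgue_on \<Omega>. (weak_laplacian \<Omega> u x)\<^sup>2) + measure lebesgue {x \<in> \<Omega>. u x > 0}"

definition global_minimizer :: "('a::euclidean_space \<Rightarrow> real) \<Rightarrow> bool" where
  "global_minimizer u \<longleftrightarrow> u \<in> H2_loc \<and>
     (\<forall>\<Omega> v. open \<Omega> \<and> bounded \<Omega> \<and> v \<in> H2 \<Omega> \<and> (\<lambda>x. v x - u x) \<in> H2_0 \<Omega>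
        \<longrightarrow> AC_functional u \<Omega> \<le> AC_functional v \<Omega>)"

end

theory Submission imports Defs "HOL-Computational_Algebra.Polynomial" begin

text \<open>
The half parabola \<open>u\<close> has the second derivative \<open>1\<close> on the right half line and \<open>0\<close> on the left, and this
jump at the free boundary point \<open>0\<close> makes it profitable to bend \<open>u\<close> there. Let \<open>\<phi>\<close> be a test
function on \<open>(-1,1)\<close> of the form \<open>x\<close> times a bump that is positive at \<open>0\<close>. Since \<open>\<phi>\<close> is nonpositive on
the left half line, \<open>u + c \<phi>\<close> with \<open>c \<ge> 0\<close> is positive only where \<open>u\<close> is, and the measure term does not
grow. The bending energy changes by \<open>2 c\<close> times the integral of \<open>\<phi>''\<close> over \<open>(0,1)\<close> plus a multiple of
\<open>c\<^sup>2\<close>. That integral is \<open>-\<phi>'(0) < 0\<close>, so for small \<open>c > 0\<close> the functional drops strictly. This is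
\<open>AC_functional_half_parabola_variation\<close>. As the variation is itself a test function, it lies in
\<open>H2_0\<close> without any approximation.

Two general facts connect this computation with the Sobolev definitions. First, a function that is
continuously differentiable with a derivative that is differentiable off a finite set, with a locally
bounded result, has these derivatives as weak ones (\<open>twice_diff_off_finite_has_weak_deriv\<close>); this is
integration by parts. Second, the functional and the norm are defined through an unspecified choice
of weak derivative, so weak derivatives must be shown to be unique almost everywhere
(\<open>has_weak_deriv_unique\<close>). This is the fundamental lemma of the calculus of variations, obtained from
smooth bumps that converge to indicators of intervals. The bumps are products of
\<open>exp(-1/x)\<close>, extended by zero and taken at affine arguments.
\<close>

section \<open>Smooth functions of one variable with compact support\<close>

lemma partial_deriv_real:
  fixes f g :: "real \<Rightarrow> real"
  assumes "\<And>x. (f has_real_derivative g x) (at x)"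
  shows "partial_deriv 1 f = g"
proof
  fix x
  have "(f has_derivative (*) (g x)) (at x)"
    using assms has_field_derivative_def by blast
  then have "frechet_derivative f (at x) = (*) (g x)"
    by (rule frechet_derivative_at[symmetric])
  then show "partial_deriv 1 f x = g x"
    by (simp add: partial_deriv_def)
qed

text \<open>A set of functions that contains a derivative of each of its members contains all iterated
derivatives of its members. So smoothness can be checked by exhibiting such a set, without formulas
for the higher derivatives.\<close>
lemma smooth_of_derivative_closed:
  fixes f :: "real \<Rightarrow> real"
  assumes closed: "\<And>f. f \<in> S \<Longrightarrow> \<exists>g\<in>S. \<forall>x. (f has_real_derivative g x) (at x)"
    and "f \<in> S"
  shows "smooth f"
  unfolding smooth_def
proof (intro ballI allI)
  fix ds :: "real list" and x :: real
  assume "ds \<in> lists Basis"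
  then have "partial_derivs ds f \<in> S"
  proof (induction ds)
    case (Cons d ds)
    then obtain g where "g \<in> S" "\<forall>x. (partial_derivs ds f has_real_derivative g x) (at x)"
      using closed by blast
    then show ?case using Cons.hyps partial_deriv_real by auto
  qed (simp add: \<open>f \<in> S\<close>)
  then show "partial_derivs ds f differentiable at x"
    using closed real_differentiable_def by blast
qed

text \<open>The functions \<open>P(1/x) exp(-1/x)\<close> on the right half line, extended by zero. Allowing a polynomial factor
\<open>P\<close> makes the family closed under differentiation; the case \<open>P = 1\<close> is the classical smooth function
that vanishes to infinite order at \<open>0\<close>.\<close>
definition flat :: "real poly \<Rightarrow> real \<Rightarrow> real" where
  "flat p x = (if x > 0 then poly p (1 / x) * exp (- (1 / x)) else 0)"

lemma poly_times_exp_minus_tendsto_0: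
  fixes p :: "real poly"
  shows "((\<lambda>y. poly p y * exp (- y)) \<longlongrightarrow> 0) at_top"
proof -
  have "((\<lambda>y. \<Sum>i\<le>degree p. coeff p i * (y ^ i / exp y)) \<longlongrightarrow> (\<Sum>i\<le>degree p. coeff p i * 0)) at_top"
    by (intro tendsto_intros tendsto_power_div_exp_0)
  then show ?thesis
    by (simp add: poly_altdef sum_divide_distrib exp_minus divide_inverse[symmetric])
qed

lemma flat_tendsto_0: "(flat p \<longlongrightarrow> 0) (at 0)"
proof (rule filterlim_split_at_real)
  have "\<forall>\<^sub>F x in at_left 0. flat p x = 0"
    by (auto simp: flat_def eventually_at_filter)
  then show "(flat p \<longlongrightarrow> 0) (at_left 0)"
    by (rule tendsto_eventually)
  have "((\<lambda>x. poly p (1 / x) * exp (- (1 / x))) \<longlongrightarrow> 0) (at_right (0::real))"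
    by (rule filterlim_compose[OF poly_times_exp_minus_tendsto_0])
      (simp add: filterlim_inverse_at_top_right divide_inverse)
  moreover have "\<forall>\<^sub>F x in at_right 0. flat p x = poly p (1 / x) * exp (- (1 / x))"
    by (auto simp: flat_def eventually_at_filter)
  ultimately show "(flat p \<longlongrightarrow> 0) (at_right 0)"
    by (simp cong: tendsto_cong)
qed

text \<open>Away from \<open>0\<close> this is the chain rule, with \<open>X\<^sup>2 (P - P')\<close> as the new polynomial. At \<open>0\<close> the difference
quotient of \<open>flat P\<close> is \<open>flat (X P)\<close>, which tends to \<open>0\<close> because the exponential beats every power.\<close>
lemma flat_has_derivative:
  "(flat p has_real_derivative flat (monom 1 2 * (p - pderiv p)) x) (at x)"
proof -
  consider "x > 0" | "x = 0" | "x < 0" by linarith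
  then show ?thesis
  proof cases
    case 1
    have "((\<lambda>x. poly p (1 / x) * exp (- (1 / x))) has_real_derivative
        flat (monom 1 2 * (p - pderiv p)) x) (at x)"
      using 1 by (auto intro!: derivative_eq_intros DERIV_chain'[OF _ poly_DERIV]
          simp: flat_def poly_monom field_simps power2_eq_square)
    then show ?thesis
      by (rule has_field_derivative_transform_within_open[where S = "{0<..}"])
        (use 1 in \<open>auto simp: flat_def\<close>)
  next
    case 2
    have "flat p h / h = flat (monom 1 1 * p) h" for h
      by (simp add: flat_def poly_monom)
    then have "((\<lambda>h. flat p h / h) \<longlongrightarrow> 0) (at 0)"
      using flat_tendsto_0[of "monom 1 1 * p"] by presburger
    then show ?thesis
      using 2 by (simp add: DERIV_def flat_def)
  next
    case 3
    have "((\<lambda>x. 0) has_real_derivative flat (monom 1 2 * (p - pderiv p)) x) (at x)"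
      using 3 by (auto simp: flat_def)
    then show ?thesis
      by (rule has_field_derivative_transform_within_open[where S = "{..<0}"])
        (use 3 in \<open>auto simp: flat_def\<close>)
  qed
qed

text \<open>Sums and products keep the derivative inside the set by the usual rules, so this algebra is large
enough to contain the cut-off functions used below and each of its members is smooth.\<close>
inductive_set flat_algebra :: "(real \<Rightarrow> real) set" where
  flat: "(\<lambda>x. flat p (a * x + b)) \<in> flat_algebra"
| const: "(\<lambda>x. c) \<in> flat_algebra"
| ident: "(\<lambda>x. x) \<in> flat_algebra"
| add: "f \<in> flat_algebra \<Longrightarrow> g \<in> flat_algebra \<Longrightarrow> (\<lambda>x. f x + g x) \<in> flat_algebra"
| mult: "f \<in> flat_algebra \<Longrightarrow> g \<in> flat_algebra \<Longrightarrow> (\<lambda>x. f x * g x) \<in> flat_algebra"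

lemma flat_algebra_derivative:
  assumes "f \<in> flat_algebra"
  shows "\<exists>g\<in>flat_algebra. \<forall>x. (f has_real_derivative g x) (at x)"
  using assms
proof induction
  case (flat p a b)
  have "((\<lambda>x. flat p (a * x + b)) has_real_derivative
      flat (monom 1 2 * (p - pderiv p)) (a * x + b) * a) (at x)" for x
    by (rule DERIV_chain2[OF flat_has_derivative]) (auto intro!: derivative_eq_intros)
  then show ?case
    by (intro bexI[of _ "\<lambda>x. flat (monom 1 2 * (p - pderiv p)) (a * x + b) * a"])
      (blast, rule flat_algebra.intros(5), rule flat_algebra.flat, rule flat_algebra.const)
next
  case (const c)
  show ?case by (rule bexI[OF _ flat_algebra.const[of 0]]) simp
next
  case ident
  show ?case by (rule bexI[OF _ flat_algebra.const[of 1]]) simp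
next
  case (add f g)
  then obtain f' g' where "f' \<in> flat_algebra" "g' \<in> flat_algebra"
    "\<forall>x. (f has_real_derivative f' x) (at x)" "\<forall>x. (g has_real_derivative g' x) (at x)" by blast
  then show ?case
    by (intro bexI[of _ "\<lambda>x. f' x + g' x"]) (auto intro: flat_algebra.intros derivative_intros)
next
  case (mult f g)
  then obtain f' g' where "f' \<in> flat_algebra" "g' \<in> flat_algebra"
    "\<forall>x. (f has_real_derivative f' x) (at x)" "\<forall>x. (g has_real_derivative g' x) (at x)" by blast
  then show ?case using mult.hyps
    by (intro bexI[of _ "\<lambda>x. f' x * g x + g' x * f x"])
      (auto intro: flat_algebra.intros DERIV_mult)
qed

lemma smooth_flat_algebra: "f \<in> flat_algebra \<Longrightarrow> smooth f"
  using smooth_of_derivative_closed flat_algebra_derivative by blast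

text \<open>A smooth function that is positive exactly on \<open>(a,b)\<close> when \<open>k > 0\<close>. The parameter \<open>k\<close> controls the
steepness at the two endpoints: as \<open>k\<close> grows the function approaches the indicator of \<open>(a,b)\<close>.\<close>
definition bump :: "real \<Rightarrow> real \<Rightarrow> real \<Rightarrow> real \<Rightarrow> real" where
  "bump a b k x = flat 1 (k * x + - (k * a)) * flat 1 (- k * x + k * b)"

lemma bump_in_flat_algebra: "bump a b k \<in> flat_algebra"
  unfolding bump_def[abs_def] by (intro flat_algebra.intros)

lemma flat_1_bounds: "0 \<le> flat 1 x" "flat 1 x \<le> 1"
  by (auto simp: flat_def)

lemma bump_bounds: "0 \<le> bump a b k x" "bump a b k x \<le> 1"
  by (auto simp: bump_def flat_1_bounds mult_le_one)

lemma bump_eq: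
  assumes "k > 0"
  shows "bump a b k x =
    (if a < x \<and> x < b then exp (- (1 / (k * (x - a)))) * exp (- (1 / (k * (b - x)))) else 0)"
proof -
  have "k * x + - (k * a) = k * (x - a)" "- k * x + k * b = k * (b - x)"
    by (auto simp: algebra_simps)
  then show ?thesis using assms
    by (auto simp: bump_def flat_def zero_less_mult_iff simp del: mult_minus_left)
qed

text \<open>Raising the steepness, rather than mollifying, gives smooth approximations to the indicator of an
interval that all have their support in the closed interval and values in \<open>[0,1]\<close>; hence dominated
convergence applies to their integrals against a locally integrable function.\<close>
lemma bump_tendsto_indicator:
  "(\<lambda>n. bump a b (real (Suc n)) x) \<longlonglongrightarrow> indicator {a<..<b} x"
proof (cases "a < x \<and> x < b")
  case True
  have exp_1: "(\<lambda>n. exp (- (1 / (real (Suc n) * c)))) \<longlonglongrightarrow> 1" if "c > 0" for c :: real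
  proof -
    have "(\<lambda>n. exp (- (inverse (real (Suc n)) * (1 / c)))) \<longlonglongrightarrow> exp (- (0 * (1 / c)))"
      by (intro tendsto_intros LIMSEQ_inverse_real_of_nat)
    then show ?thesis by (simp add: field_simps)
  qed
  have "(\<lambda>n. exp (- (1 / (real (Suc n) * (x - a)))) * exp (- (1 / (real (Suc n) * (b - x)))))
      \<longlonglongrightarrow> 1 * 1"
    using True by (intro tendsto_mult exp_1) auto
  then show ?thesis using True by (simp add: bump_eq)
next
  case False
  then show ?thesis by (simp only: bump_eq of_nat_0_less_iff if_False) simp
qed

lemma flat_algebra_test_function:
  assumes "f \<in> flat_algebra" "\<And>x. x \<notin> {a..b} \<Longrightarrow> f x = 0" "{a..b} \<subseteq> \<Omega>"
  shows "f \<in> test_functions \<Omega>"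
proof -
  have "closure {x. f x \<noteq> 0} \<subseteq> {a..b}"
    using assms(2) by (intro closure_minimal) (blast, simp)
  moreover from this have "compact (closure {x. f x \<noteq> 0})"
    using compact_eq_bounded_closed bounded_subset[OF bounded_closed_interval] by blast
  ultimately show ?thesis using assms(1,3)
    by (auto simp: test_functions_def smooth_flat_algebra)
qed

section \<open>Classical derivatives are weak derivatives\<close>

lemma partial_derivs_snoc: "partial_derivs (ds @ [d]) f = partial_derivs ds (partial_deriv d f)"
  by (induction ds) auto

lemma test_function_has_derivative:
  fixes \<phi> :: "real \<Rightarrow> real"
  assumes "\<phi> \<in> test_functions \<Omega>"
  shows "(\<phi> has_real_derivative partial_deriv 1 \<phi> x) (at x)"
proof -
  have "\<forall>x. \<phi> differentiable at x"
    using assms unfolding test_functions_def smooth_def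
    by (metis (mono_tags, lifting) lists.Nil mem_Collect_eq partial_derivs.simps(1))
  then obtain g where "\<And>x. (\<phi> has_real_derivative g x) (at x)"
    unfolding real_differentiable_def by metis
  then show ?thesis using partial_deriv_real by metis
qed

text \<open>The derivative vanishes on the open complement of the support of \<open>\<phi>\<close>, where \<open>\<phi>\<close> is locally zero, so
differentiation does not enlarge the support.\<close>
lemma partial_deriv_test_function:
  fixes \<phi> :: "real \<Rightarrow> real"
  assumes "\<phi> \<in> test_functions \<Omega>"
  shows "partial_deriv 1 \<phi> \<in> test_functions \<Omega>"
proof -
  let ?K = "closure {x. \<phi> x \<noteq> 0}"
  have \<phi>: "smooth \<phi>" "compact ?K" "?K \<subseteq> \<Omega>"
    using assms by (auto simp: test_functions_def)
  have "smooth (partial_deriv 1 \<phi>)"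
    unfolding smooth_def
  proof (intro ballI allI)
    fix ds :: "real list" and x
    assume "ds \<in> lists Basis"
    then have "ds @ [1] \<in> lists Basis" by simp
    then show "partial_derivs ds (partial_deriv 1 \<phi>) differentiable at x"
      using \<phi>(1) unfolding smooth_def by (metis partial_derivs_snoc)
  qed
  moreover have "partial_deriv 1 \<phi> x = 0" if "x \<notin> ?K" for x
  proof -
    have "((\<lambda>x. 0) has_real_derivative partial_deriv 1 \<phi> x) (at x)"
      by (rule has_field_derivative_transform_within_open
            [OF test_function_has_derivative[OF assms], where S = "- ?K"])
        (use that closure_subset[of "{x. \<phi> x \<noteq> 0}"] in auto)
    then show ?thesis using DERIV_unique DERIV_const by blast
  qed
  then have K': "closure {x. partial_deriv 1 \<phi> x \<noteq> 0} \<subseteq> ?K"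
    by (intro closure_minimal) auto
  then have "compact (closure {x. partial_deriv 1 \<phi> x \<noteq> 0})"
    using \<phi>(2) bounded_subset by (auto simp: compact_eq_bounded_closed)
  ultimately show ?thesis
    using \<phi>(3) K' by (auto simp: test_functions_def)
qed

lemma continuous_on_of_real_derivative:
  assumes "\<And>x. (f has_real_derivative g x) (at x)"
  shows "continuous_on A f"
  using assms DERIV_isCont continuous_at_imp_continuous_on by blast

text \<open>A class of integrands that contains the continuous functions and the jump function
\<open>indicator {0<..}\<close>, is closed under sums and products, and is integrable over bounded sets. It spares
separate integrability arguments for each expression that occurs below.\<close>
definition locally_bounded_borel :: "(real \<Rightarrow> real) \<Rightarrow> bool" where
  "locally_bounded_borel g \<longleftrightarrow>
    g \<in> borel_measurable borel \<and> (\<forall>R. \<exists>B. \<forall>x\<in>{-R..R}. \<bar>g x\<bar> \<le> B)"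

lemma locally_bounded_borel_bound:
  assumes "locally_bounded_borel g"
  obtains B where "\<And>x. x \<in> {-R..R} \<Longrightarrow> \<bar>g x\<bar> \<le> B"
  using assms unfolding locally_bounded_borel_def by blast

lemma locally_bounded_borel_continuous:
  assumes "continuous_on UNIV g"
  shows "locally_bounded_borel g"
  unfolding locally_bounded_borel_def
proof (intro conjI allI)
  show "g \<in> borel_measurable borel"
    using assms borel_measurable_continuous_onI by blast
  fix R :: real
  have "compact (g ` {-R..R})"
    using assms by (intro compact_continuous_image) (auto intro: continuous_on_subset)
  then have "bounded (g ` {-R..R})" by (rule compact_imp_bounded)
  then show "\<exists>B. \<forall>x\<in>{-R..R}. \<bar>g x\<bar> \<le> B"
    by (auto simp: bounded_iff)
qed

lemma locally_bounded_borel_mult: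
  assumes "locally_bounded_borel f" "locally_bounded_borel g"
  shows "locally_bounded_borel (\<lambda>x. f x * g x)"
  unfolding locally_bounded_borel_def
proof (intro conjI allI)
  show "(\<lambda>x. f x * g x) \<in> borel_measurable borel"
    using assms by (auto simp: locally_bounded_borel_def)
  fix R :: real
  obtain B where B: "\<And>x. x \<in> {-R..R} \<Longrightarrow> \<bar>f x\<bar> \<le> B"
    using locally_bounded_borel_bound[OF assms(1)] by blast
  obtain C where C: "\<And>x. x \<in> {-R..R} \<Longrightarrow> \<bar>g x\<bar> \<le> C"
    using locally_bounded_borel_bound[OF assms(2)] by blast
  have "\<bar>f x * g x\<bar> \<le> B * C" if "x \<in> {-R..R}" for x
    using mult_mono'[OF B[OF that] C[OF that]] by (simp add: abs_mult)
  then show "\<exists>B. \<forall>x\<in>{-R..R}. \<bar>f x * g x\<bar> \<le> B" by blast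
qed

lemma locally_bounded_borel_add:
  assumes "locally_bounded_borel f" "locally_bounded_borel g"
  shows "locally_bounded_borel (\<lambda>x. f x + g x)"
  unfolding locally_bounded_borel_def
proof (intro conjI allI)
  show "(\<lambda>x. f x + g x) \<in> borel_measurable borel"
    using assms by (auto simp: locally_bounded_borel_def)
  fix R :: real
  obtain B where B: "\<And>x. x \<in> {-R..R} \<Longrightarrow> \<bar>f x\<bar> \<le> B"
    using locally_bounded_borel_bound[OF assms(1)] by blast
  obtain C where C: "\<And>x. x \<in> {-R..R} \<Longrightarrow> \<bar>g x\<bar> \<le> C"
    using locally_bounded_borel_bound[OF assms(2)] by blast
  have "\<bar>f x + g x\<bar> \<le> B + C" if "x \<in> {-R..R}" for x
    using B[OF that] C[OF that] by linarith
  then show "\<exists>B. \<forall>x\<in>{-R..R}. \<bar>f x + g x\<bar> \<le> B" by blast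
qed

lemma locally_bounded_borel_measurable:
  assumes "locally_bounded_borel g"
  shows "g \<in> borel_measurable (lebesgue_on A)"
  using assms unfolding locally_bounded_borel_def
  by (intro measurable_restrict_space1 measurable_completion) simp

lemma locally_bounded_borel_integrable:
  assumes "locally_bounded_borel g" "bounded A" "A \<in> sets lebesgue"
  shows "integrable (lebesgue_on A) g"
proof -
  obtain R where "A \<subseteq> {-R..R}"
    using \<open>bounded A\<close> bounded_subset_cbox_symmetric by (metis cbox_interval)
  moreover obtain B where "\<And>x. x \<in> {-R..R} \<Longrightarrow> \<bar>g x\<bar> \<le> B"
    using locally_bounded_borel_bound[OF assms(1)] by blast
  ultimately have "AE x in lebesgue_on A. norm (g x) \<le> B"
    by (intro AE_I2) auto
  moreover have "finite_measure (lebesgue_on A)"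
    using assms bounded_set_imp_lmeasurable by (intro finite_measure_lebesgue_on) auto
  ultimately show ?thesis
    using assms(1) finite_measure.integrable_const_bound locally_bounded_borel_measurable by blast
qed

text \<open>Test functions vanish off a compact set, so integrals over \<open>\<Omega>\<close> can be moved to an interval, where the
fundamental theorem of calculus is available.\<close>
lemma lebesgue_on_superset:
  fixes f :: "real \<Rightarrow> real"
  assumes "K \<subseteq> T" "K \<in> sets lebesgue" "T \<in> sets lebesgue" "\<And>x. x \<notin> K \<Longrightarrow> f x = 0"
  shows "(LINT x|lebesgue_on T. f x) = (LINT x|lebesgue_on K. f x)"
    and "integrable (lebesgue_on T) f \<longleftrightarrow> integrable (lebesgue_on K) f"
proof -
  have f: "f = (\<lambda>x. if x \<in> K then f x else 0)" "f = (\<lambda>x. if x \<in> T then f x else 0)"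
    using assms by (auto simp: fun_eq_iff)
  show "(LINT x|lebesgue_on T. f x) = (LINT x|lebesgue_on K. f x)"
    using Lebesgue_Measure.integral_restrict_UNIV[of K f] Lebesgue_Measure.integral_restrict_UNIV[of T f] assms f by simp
  show "integrable (lebesgue_on T) f \<longleftrightarrow> integrable (lebesgue_on K) f"
    using Lebesgue_Measure.integrable_restrict_UNIV[of K f] Lebesgue_Measure.integrable_restrict_UNIV[of T f] assms f by simp
qed

text \<open>The product \<open>F \<phi>\<close> is continuous, has the derivative \<open>F \<phi>' + G \<phi>\<close> off the finite set \<open>S\<close>, and vanishes at
the ends of a large interval. By the fundamental theorem of calculus the integral of this derivative
is zero.\<close>
lemma test_function_integration_by_parts:
  fixes F G :: "real \<Rightarrow> real"
  assumes \<phi>: "\<phi> \<in> test_functions \<Omega>" and "open \<Omega>"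
    and F: "continuous_on UNIV F" and G: "locally_bounded_borel G"
    and "finite S" and deriv: "\<And>x. x \<notin> S \<Longrightarrow> (F has_real_derivative G x) (at x)"
  shows "(LINT x|lebesgue_on \<Omega>. F x * partial_deriv 1 \<phi> x) = - (LINT x|lebesgue_on \<Omega>. G x * \<phi> x)"
proof -
  let ?\<phi>' = "partial_deriv 1 \<phi>"
  let ?K = "closure {x. \<phi> x \<noteq> 0}" and ?K' = "closure {x. ?\<phi>' x \<noteq> 0}"
  have \<phi>': "?\<phi>' \<in> test_functions \<Omega>"
    using \<phi> by (rule partial_deriv_test_function)
  have K: "compact (?K \<union> ?K')" "?K \<union> ?K' \<subseteq> \<Omega>"
    using \<phi> \<phi>' by (auto simp: test_functions_def)
  have "bounded (insert 0 (?K \<union> ?K'))" using compact_imp_bounded[OF K(1)] by simp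
  then obtain R where "insert 0 (?K \<union> ?K') \<subseteq> {-R<..<R}"
    using bounded_subset_box_symmetric by (metis box_real(1))
  then have "R > 0" and R: "?K \<union> ?K' \<subseteq> {-R<..<R}"
    by auto
  have zero: "\<phi> x = 0 \<and> ?\<phi>' x = 0" if "x \<notin> ?K \<union> ?K'" for x
    using that closure_subset[of "{x. \<phi> x \<noteq> 0}"] closure_subset[of "{x. ?\<phi>' x \<noteq> 0}"] by auto
  have cont: "continuous_on UNIV \<phi>" "continuous_on UNIV ?\<phi>'"
    by (rule continuous_on_of_real_derivative[OF test_function_has_derivative], fact)+
  have lbb: "locally_bounded_borel (\<lambda>x. F x * ?\<phi>' x)" "locally_bounded_borel (\<lambda>x. G x * \<phi> x)"
    using F G cont by (auto intro: locally_bounded_borel_mult locally_bounded_borel_continuous)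
  have move: "(LINT x|lebesgue_on \<Omega>. h x) = (LINT x|lebesgue_on {-R..R}. h x)"
    if "\<And>x. x \<notin> ?K \<union> ?K' \<Longrightarrow> h x = 0" for h :: "real \<Rightarrow> real"
  proof -
    have sets: "?K \<union> ?K' \<in> sets lebesgue" "\<Omega> \<in> sets lebesgue"
      using \<open>open \<Omega>\<close> by (auto simp: sets_completionI_sets)
    have "?K \<union> ?K' \<subseteq> {-R..R}"
      using R greaterThanLessThan_subseteq_atLeastAtMost_iff[of "-R" R "-R" R] by (meson order.refl order_trans)
    then have "(LINT x|lebesgue_on {-R..R}. h x) = (LINT x|lebesgue_on (?K \<union> ?K'). h x)"
      by (rule lebesgue_on_superset(1)[OF _ sets(1) _ that]) simp
    moreover have "(LINT x|lebesgue_on \<Omega>. h x) = (LINT x|lebesgue_on (?K \<union> ?K'). h x)"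
      by (rule lebesgue_on_superset(1)[OF K(2) sets that])
    ultimately show ?thesis by (rule trans[OF _ sym, rotated])
  qed
  have ftc: "((\<lambda>x. F x * ?\<phi>' x + G x * \<phi> x) has_integral F R * \<phi> R - F (- R) * \<phi> (- R)) {-R..R}"
  proof (rule fundamental_theorem_of_calculus_strong[OF \<open>finite S\<close>])
    show "continuous_on {-R..R} (\<lambda>x. F x * \<phi> x)"
      using F cont by (intro continuous_on_mult) (auto intro: continuous_on_subset)
    show "((\<lambda>x. F x * \<phi> x) has_vector_derivative F x * ?\<phi>' x + G x * \<phi> x) (at x)"
      if "x \<in> {-R..R} - S" for x
      using that DERIV_mult[OF deriv[of x] test_function_has_derivative[OF \<phi>]]
      by (simp add: has_real_derivative_iff_has_vector_derivative algebra_simps)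
  qed (use \<open>R > 0\<close> in auto)
  have ends: "\<phi> R = 0" "\<phi> (- R) = 0"
  proof -
    have "R \<notin> ?K \<union> ?K'" "- R \<notin> ?K \<union> ?K'" using R by (meson subsetD greaterThanLessThan_iff less_irrefl)+
    then show "\<phi> R = 0" "\<phi> (- R) = 0" using zero by blast+
  qed
  have "((\<lambda>x. F x * ?\<phi>' x + G x * \<phi> x) has_integral
     (LINT x|lebesgue_on {-R..R}. F x * ?\<phi>' x + G x * \<phi> x)) {-R..R}"
    by (intro has_integral_integral_lebesgue_on locally_bounded_borel_integrable
        locally_bounded_borel_add lbb) auto
  then have "(LINT x|lebesgue_on {-R..R}. F x * ?\<phi>' x + G x * \<phi> x) = F R * \<phi> R - F (- R) * \<phi> (- R)"
    using ftc by (rule has_integral_unique)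
  then have "(LINT x|lebesgue_on {-R..R}. F x * ?\<phi>' x + G x * \<phi> x) = 0"
    unfolding ends by simp
  moreover have int: "integrable (lebesgue_on {-R..R}) (\<lambda>x. F x * ?\<phi>' x)"
    "integrable (lebesgue_on {-R..R}) (\<lambda>x. G x * \<phi> x)"
    by (intro locally_bounded_borel_integrable lbb; simp)+
  ultimately have "(LINT x|lebesgue_on {-R..R}. F x * ?\<phi>' x) + (LINT x|lebesgue_on {-R..R}. G x * \<phi> x) = 0"
    using Bochner_Integration.integral_add[OF int] by linarith
  moreover have "(LINT x|lebesgue_on \<Omega>. F x * ?\<phi>' x) = (LINT x|lebesgue_on {-R..R}. F x * ?\<phi>' x)"
    by (rule move) (metis zero mult_zero_right)
  moreover have "(LINT x|lebesgue_on \<Omega>. G x * \<phi> x) = (LINT x|lebesgue_on {-R..R}. G x * \<phi> x)"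
    by (rule move) (metis zero mult_zero_right)
  ultimately show ?thesis by linarith
qed

text \<open>The regularity of the half parabola: \<open>f1\<close> is a continuous derivative of \<open>f\<close>, and \<open>f2\<close> is a locally
bounded derivative of \<open>f1\<close> off finitely many points. The values of \<open>f2\<close> at the exceptional points are
arbitrary, as they do not affect any integral.\<close>
definition twice_diff_off_finite :: "(real \<Rightarrow> real) \<Rightarrow> (real \<Rightarrow> real) \<Rightarrow> (real \<Rightarrow> real) \<Rightarrow> bool" where
  "twice_diff_off_finite f f1 f2 \<longleftrightarrow>
    (\<forall>x. (f has_real_derivative f1 x) (at x)) \<and> continuous_on UNIV f1 \<and> locally_bounded_borel f2 \<and>
    (\<exists>S. finite S \<and> (\<forall>x. x \<notin> S \<longrightarrow> (f1 has_real_derivative f2 x) (at x)))"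

lemma twice_diff_off_finite_locally_bounded:
  assumes "twice_diff_off_finite f f1 f2"
  shows "locally_bounded_borel f" "locally_bounded_borel f1" "locally_bounded_borel f2"
  using assms continuous_on_of_real_derivative
  by (auto simp: twice_diff_off_finite_def intro!: locally_bounded_borel_continuous)

lemma locally_bounded_borel_locally_integrable:
  "locally_bounded_borel f \<Longrightarrow> locally_integrable \<Omega> f"
  by (auto simp: locally_integrable_def
      intro!: locally_bounded_borel_integrable compact_imp_bounded sets_completionI_sets
      dest: compact_imp_closed)

lemma twice_diff_off_finite_has_weak_deriv:
  assumes f: "twice_diff_off_finite f f1 f2" and "open \<Omega>"
  shows "has_weak_deriv \<Omega> [1] f f1" and "has_weak_deriv \<Omega> [1, 1] f f2"
proof -
  obtain S where S: "finite S" "\<And>x. x \<notin> S \<Longrightarrow> (f1 has_real_derivative f2 x) (at x)"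
    using f by (auto simp: twice_diff_off_finite_def)
  have f1: "\<And>x. (f has_real_derivative f1 x) (at x)" "continuous_on UNIV f1"
    using f by (auto simp: twice_diff_off_finite_def)
  note lbb = twice_diff_off_finite_locally_bounded[OF f]
  have "(LINT x|lebesgue_on \<Omega>. f x * partial_deriv 1 \<phi> x) = - (LINT x|lebesgue_on \<Omega>. f1 x * \<phi> x)"
    if "\<phi> \<in> test_functions \<Omega>" for \<phi>
    using that f1(1) continuous_on_of_real_derivative[OF f1(1)] \<open>open \<Omega>\<close> lbb
    by (intro test_function_integration_by_parts[where S = "{}"]) auto
  moreover have "(LINT x|lebesgue_on \<Omega>. f1 x * partial_deriv 1 \<phi> x) = - (LINT x|lebesgue_on \<Omega>. f2 x * \<phi> x)"
    if "\<phi> \<in> test_functions \<Omega>" for \<phi>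
    using that f1(2) S \<open>open \<Omega>\<close> lbb
    by (intro test_function_integration_by_parts[where S = S]) auto
  ultimately show "has_weak_deriv \<Omega> [1] f f1" "has_weak_deriv \<Omega> [1, 1] f f2"
    using lbb by (auto simp: has_weak_deriv_def locally_bounded_borel_locally_integrable
        partial_deriv_test_function)
qed

lemma locally_bounded_borel_L2:
  assumes "locally_bounded_borel f" "bounded \<Omega>" "\<Omega> \<in> sets lebesgue"
  shows "f \<in> L2 \<Omega>"
  using assms unfolding L2_def power2_eq_square
  by (auto intro: locally_bounded_borel_measurable locally_bounded_borel_integrable
      locally_bounded_borel_mult)

lemma twice_diff_off_finite_H2:
  assumes f: "twice_diff_off_finite f f1 f2" and "open \<Omega>" "bounded \<Omega>"
  shows "f \<in> H2 \<Omega>"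
proof -
  have "\<Omega> \<in> sets lebesgue" using \<open>open \<Omega>\<close> by (simp add: sets_completionI_sets)
  then show ?thesis
    using twice_diff_off_finite_has_weak_deriv[OF f \<open>open \<Omega>\<close>] twice_diff_off_finite_locally_bounded[OF f]
      locally_bounded_borel_L2[OF _ \<open>bounded \<Omega>\<close>]
    unfolding H2_def by auto
qed

section \<open>Uniqueness of weak derivatives on open subsets of the line\<close>

text \<open>Open intervals form an intersection-stable generator of the Borel sets, and the sets over which \<open>h\<close>
integrates to zero are closed under complements and countable disjoint unions. Hence \<open>h\<close> integrates
to zero over every Borel set.\<close>
lemma AE_zero_of_integral_intervals_zero:
  fixes h :: "real \<Rightarrow> real"
  assumes h: "integrable lborel h"
    and zero: "\<And>a b. (LINT x:{a<..<b}|lborel. h x) = 0"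
  shows "AE x in lborel. h x = 0"
proof (rule density_unique_real[OF h, of "\<lambda>x. 0", simplified])
  have set_int: "set_integrable lborel A h" if "A \<in> sets borel" for A
    unfolding set_integrable_def using that h by (intro integrable_mult_indicator) auto
  \<comment> \<open>Closure under complements needs the integral over the whole line, which is not an interval integral but a limit of such.\<close>
  have "(\<lambda>n. LINT x:{- real n<..<real n}|lborel. h x) \<longlonglongrightarrow> (LINT x:(\<Union>n. {- real n<..<real n})|lborel. h x)"
    by (intro set_integral_cont_up set_int) (auto simp: incseq_def)
  moreover have "(\<Union>n. {- real n<..<real n}) = UNIV"
  proof (intro equalityI subsetI UNIV_I)
    fix x :: real
    obtain n where "\<bar>x\<bar> < real n" using reals_Archimedean2 by blast
    then show "x \<in> (\<Union>n. {- real n<..<real n})" by (intro UN_I[of n]) auto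
  qed
  ultimately have total: "(LINT x:UNIV|lborel. h x) = 0"
    using zero LIMSEQ_unique[OF _ tendsto_const] by simp
  fix A :: "real set"
  assume "A \<in> sets borel"
  then have gen: "A \<in> sigma_sets UNIV (range (\<lambda>(a, b). {a<..<b}))"
    by (simp add: borel_eq_box[where 'a = real] box_real)
  have "Int_stable (range (\<lambda>(a::real, b). {a<..<b}))"
  proof (rule Int_stableI)
    fix I J assume "I \<in> range (\<lambda>(a::real, b). {a<..<b})" "J \<in> range (\<lambda>(a::real, b). {a<..<b})"
    then obtain a b c d where "I = {a<..<b}" "J = {c<..<d}" by auto
    then have "I \<inter> J = {max a c<..<min b d}" by auto
    then show "I \<inter> J \<in> range (\<lambda>(a::real, b). {a<..<b})" by auto
  qed
  moreover have "range (\<lambda>(a::real, b). {a<..<b}) \<subseteq> Pow UNIV" by simp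
  moreover note gen
  ultimately show "(LINT x:A|lborel. h x) = 0"
  proof (induction rule: sigma_sets_induct_disjoint)
    case (basic A)
    then show ?case using zero by auto
  next
    case (compl A)
    then have A: "A \<in> sets borel"
      by (simp add: borel_eq_box[where 'a = real] box_real)
    have "(LINT x:UNIV|lborel. h x) = (LINT x:A \<union> (UNIV - A)|lborel. h x)" by simp
    also have "\<dots> = (LINT x:A|lborel. h x) + (LINT x:UNIV - A|lborel. h x)"
      using A by (intro set_integral_Un set_int) auto
    finally show ?case using compl.IH total by simp
  next
    case (union A)
    then have A: "A i \<in> sets borel" for i
      by (auto simp: borel_eq_box[where 'a = real] box_real)
    have "(LINT x:(\<Union>i. A i)|lborel. h x) = (\<Sum>i. LINT x:A i|lborel. h x)"
      using A union by (intro lebesgue_integral_countable_add set_int) (auto simp: disjoint_family_on_def)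
    then show ?case using union.IH by simp
  qed (auto simp: set_lebesgue_integral_def)
qed

text \<open>The integral over \<open>(a,b)\<close> is the limit of the integrals of \<open>g\<close> against bumps of growing steepness, and
each of these bumps is a test function.\<close>
lemma integral_interval_zero_of_test_functions:
  fixes g :: "real \<Rightarrow> real"
  assumes "open \<Omega>" and g: "locally_integrable \<Omega> g"
    and test: "\<And>\<phi>. \<phi> \<in> test_functions \<Omega> \<Longrightarrow> (LINT x|lebesgue_on \<Omega>. g x * \<phi> x) = 0"
    and sub: "{a..b} \<subseteq> \<Omega>"
  shows "(LINT x|lebesgue_on {a..b}. g x * indicator {a<..<b} x) = 0"
proof -
  have gab: "integrable (lebesgue_on {a..b}) g"
    using g sub by (auto simp: locally_integrable_def)
  have \<Omega>: "\<Omega> \<in> sets lebesgue" using \<open>open \<Omega>\<close> by auto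
  have bump_borel: "bump a b (real (Suc n)) \<in> borel_measurable (lebesgue_on {a..b})" for n
  proof -
    obtain d where "\<forall>x. (bump a b (real (Suc n)) has_real_derivative d x) (at x)"
      using flat_algebra_derivative bump_in_flat_algebra by blast
    then show ?thesis
      by (intro locally_bounded_borel_measurable locally_bounded_borel_continuous
          continuous_on_of_real_derivative) auto
  qed
  have "(\<lambda>n. LINT x|lebesgue_on {a..b}. g x * bump a b (real (Suc n)) x)
      \<longlonglongrightarrow> (LINT x|lebesgue_on {a..b}. g x * indicator {a<..<b} x)"
  proof (rule integral_dominated_convergence)
    show "integrable (lebesgue_on {a..b}) (\<lambda>x. \<bar>g x\<bar>)" using gab by simp
    show "(\<lambda>x. g x * bump a b (real (Suc n)) x) \<in> borel_measurable (lebesgue_on {a..b})" for n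
      using gab bump_borel by (intro borel_measurable_times) auto
    show "(\<lambda>x. g x * indicator {a<..<b} x) \<in> borel_measurable (lebesgue_on {a..b})"
      by (intro borel_measurable_times borel_measurable_integrable[OF gab] measurable_restrict_space1
          borel_measurable_indicator) auto
    show "AE x in lebesgue_on {a..b}. (\<lambda>n. g x * bump a b (real (Suc n)) x)
        \<longlonglongrightarrow> g x * indicator {a<..<b} x"
      by (intro AE_I2 tendsto_mult tendsto_const bump_tendsto_indicator)
    show "AE x in lebesgue_on {a..b}. norm (g x * bump a b (real (Suc n)) x) \<le> \<bar>g x\<bar>" for n
      by (intro AE_I2) (simp add: abs_mult bump_bounds mult_left_le del: of_nat_Suc)
  qed
  moreover have "(LINT x|lebesgue_on {a..b}. g x * bump a b (real (Suc n)) x) = 0" for n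
  proof -
    have outside: "bump a b (real (Suc n)) x = 0" if "x \<notin> {a..b}" for x
      using that by (auto simp: bump_eq)
    then have "bump a b (real (Suc n)) \<in> test_functions \<Omega>"
      using sub bump_in_flat_algebra flat_algebra_test_function by blast
    moreover have "(LINT x|lebesgue_on \<Omega>. g x * bump a b (real (Suc n)) x)
        = (LINT x|lebesgue_on {a..b}. g x * bump a b (real (Suc n)) x)"
      using sub \<Omega> outside by (intro lebesgue_on_superset) auto
    ultimately show ?thesis using test by simp
  qed
  ultimately show ?thesis
    using LIMSEQ_unique[OF _ tendsto_const] by simp
qed

text \<open>The Dynkin argument for intervals concerns Borel functions on the whole line. So \<open>g\<close> is cut off to
\<open>(a,b)\<close> and replaced by a Borel function that agrees with it almost everywhere. The cut-off uses the open
interval because the intersection of two open intervals is again open, which makes its integrals over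
intervals exactly those computed before; the endpoints are a null set.\<close>
lemma AE_zero_on_interval_of_test_functions:
  fixes g :: "real \<Rightarrow> real"
  assumes "open \<Omega>" and g: "locally_integrable \<Omega> g"
    and test: "\<And>\<phi>. \<phi> \<in> test_functions \<Omega> \<Longrightarrow> (LINT x|lebesgue_on \<Omega>. g x * \<phi> x) = 0"
    and sub: "{a..b} \<subseteq> \<Omega>"
  shows "AE x in lebesgue. x \<in> {a..b} \<longrightarrow> g x = 0"
proof -
  define h where "h x = g x * indicator {a<..<b} x" for x
  have gab: "integrable (lebesgue_on {a..b}) g"
    using g sub by (auto simp: locally_integrable_def)
  have "integrable lebesgue (\<lambda>x. indicator {a<..<b} x *\<^sub>R (if x \<in> {a..b} then g x else 0))"
    using gab by (intro integrable_mult_indicator) (simp, subst Lebesgue_Measure.integrable_restrict_UNIV, simp)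
  also have "(\<lambda>x. indicator {a<..<b} x *\<^sub>R (if x \<in> {a..b} then g x else 0)) = h"
    by (auto simp: h_def fun_eq_iff indicator_def)
  finally have h: "integrable lebesgue h" .
  then obtain h' where h': "h' \<in> borel_measurable lborel" "AE x in lborel. h x = h' x"
    using completion_ex_borel_measurable_real borel_measurable_integrable by blast
  have h'_leb: "h' \<in> borel_measurable lebesgue"
    using h'(1) by (rule measurable_completion)
  have eq_leb: "AE x in lebesgue. h x = h' x"
    using h'(2) by (rule AE_completion)
  have "integrable lebesgue h'"
    using h h'_leb eq_leb Bochner_Integration.integrable_cong_AE[of h lebesgue h'] by auto
  then have int: "integrable lborel h'"
    using h'(1) integrable_completion by blast
  have "(LINT x:{c<..<d}|lborel. h' x) = 0" for c d
  proof -
    let ?a = "max a c" and ?b = "min b d"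
    have "(LINT x:{c<..<d}|lborel. h' x) = (LINT x|lebesgue. indicator {c<..<d} x * h' x)"
      unfolding set_lebesgue_integral_def real_scaleR_def
      using h'(1) by (intro integral_completion[symmetric] borel_measurable_times) auto
    also have "\<dots> = (LINT x|lebesgue. indicator {c<..<d} x * h x)"
      using eq_leb h h'_leb
      by (intro integral_cong_AE borel_measurable_times borel_measurable_indicator) auto
    also have "(\<lambda>x. indicator {c<..<d} x * h x)
        = (\<lambda>x. if x \<in> {?a..?b} then g x * indicator {?a<..<?b} x else 0)"
      by (auto simp: h_def fun_eq_iff indicator_def)
    also have "(LINT x|lebesgue. (if x \<in> {?a..?b} then g x * indicator {?a<..<?b} x else 0))
        = (LINT x|lebesgue_on {?a..?b}. g x * indicator {?a<..<?b} x)"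
      by (rule Lebesgue_Measure.integral_restrict_UNIV) simp
    also have "\<dots> = 0"
    proof (rule integral_interval_zero_of_test_functions[OF \<open>open \<Omega>\<close> g test])
      show "{?a..?b} \<subseteq> \<Omega>" using sub by auto
    qed
    finally show ?thesis .
  qed
  then have "AE x in lebesgue. h' x = 0"
    by (intro AE_completion AE_zero_of_integral_intervals_zero int)
  moreover have "AE x in lebesgue. x \<noteq> a" "AE x in lebesgue. x \<noteq> b"
    by (intro AE_completion AE_lborel_singleton)+
  ultimately show ?thesis
    using eq_leb by eventually_elim (auto simp: h_def indicator_def)
qed

text \<open>An open set is a countable union of compact intervals, and a countable union of null sets is null.\<close>
lemma fundamental_lemma_calculus_of_variations:
  fixes g :: "real \<Rightarrow> real"
  assumes "open \<Omega>" and g: "locally_integrable \<Omega> g"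
    and test: "\<And>\<phi>. \<phi> \<in> test_functions \<Omega> \<Longrightarrow> (LINT x|lebesgue_on \<Omega>. g x * \<phi> x) = 0"
  shows "AE x in lebesgue_on \<Omega>. g x = 0"
proof -
  obtain \<D> where \<D>: "countable \<D>" "\<D> \<subseteq> Pow \<Omega>" "\<And>X. X \<in> \<D> \<Longrightarrow> \<exists>a b. X = cbox a b" "\<Union>\<D> = \<Omega>"
    using open_countable_Union_open_cbox[OF \<open>open \<Omega>\<close>] by metis
  have "AE x in lebesgue. \<forall>X\<in>\<D>. x \<in> X \<longrightarrow> g x = 0"
    unfolding AE_ball_countable[OF \<D>(1)]
  proof
    fix X assume "X \<in> \<D>"
    then obtain a b where X: "X = {a..b}" using \<D>(3) by (metis cbox_interval)
    moreover have "{a..b} \<subseteq> \<Omega>" using \<open>X \<in> \<D>\<close> \<D>(2) X by auto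
    ultimately show "AE x in lebesgue. x \<in> X \<longrightarrow> g x = 0"
      using AE_zero_on_interval_of_test_functions[OF assms] by blast
  qed
  then have "AE x in lebesgue. x \<in> \<Omega> \<longrightarrow> g x = 0"
    by eventually_elim (use \<D>(4) in blast)
  then show ?thesis
    using \<open>open \<Omega>\<close> by (subst AE_restrict_space_iff) auto
qed

text \<open>Needed to split the integral of a difference of two candidates for a weak derivative: local
integrability alone does not make them integrable on \<open>\<Omega>\<close>.\<close>
lemma integrable_mult_test_function:
  fixes g \<phi> :: "real \<Rightarrow> real"
  assumes "locally_integrable \<Omega> g" "\<phi> \<in> test_functions \<Omega>" "open \<Omega>"
  shows "integrable (lebesgue_on \<Omega>) (\<lambda>x. g x * \<phi> x)"
proof -
  let ?K = "closure {x. \<phi> x \<noteq> 0}"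
  have K: "compact ?K" "?K \<subseteq> \<Omega>" using assms(2) by (auto simp: test_functions_def)
  then have g: "integrable (lebesgue_on ?K) g"
    using assms(1) by (auto simp: locally_integrable_def)
  have cont: "continuous_on UNIV \<phi>"
    using test_function_has_derivative[OF assms(2)] by (rule continuous_on_of_real_derivative)
  then have "bounded (\<phi> ` ?K)"
    using K(1) by (intro compact_imp_bounded compact_continuous_image) (auto intro: continuous_on_subset)
  then obtain B where B: "\<And>x. x \<in> ?K \<Longrightarrow> \<bar>\<phi> x\<bar> \<le> B"
    by (auto simp: bounded_iff)
  have "integrable (lebesgue_on ?K) (\<lambda>x. g x * \<phi> x)"
  proof (rule Bochner_Integration.integrable_bound)
    show "integrable (lebesgue_on ?K) (\<lambda>x. B * g x)" using g by simp
    show "(\<lambda>x. g x * \<phi> x) \<in> borel_measurable (lebesgue_on ?K)"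
      using g locally_bounded_borel_measurable[OF locally_bounded_borel_continuous[OF cont]]
      by (intro borel_measurable_times) auto
    show "AE x in lebesgue_on ?K. norm (g x * \<phi> x) \<le> norm (B * g x)"
    proof (rule AE_I2)
      fix x assume "x \<in> space (lebesgue_on ?K)"
      then have "\<bar>\<phi> x\<bar> \<le> \<bar>B\<bar>" using B[of x] by simp
      then show "norm (g x * \<phi> x) \<le> norm (B * g x)"
        using mult_left_mono[of "\<bar>\<phi> x\<bar>" "\<bar>B\<bar>" "\<bar>g x\<bar>"] by (simp add: abs_mult mult.commute)
    qed
  qed
  moreover have "g x * \<phi> x = 0" if "x \<notin> ?K" for x
    using that closure_subset[of "{x. \<phi> x \<noteq> 0}"] by auto
  ultimately show ?thesis
    using lebesgue_on_superset(2)[of ?K \<Omega> "\<lambda>x. g x * \<phi> x"] K \<open>open \<Omega>\<close> by auto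
qed

lemma has_weak_deriv_unique:
  fixes u g g' :: "real \<Rightarrow> real"
  assumes "open \<Omega>" "has_weak_deriv \<Omega> ds u g" "has_weak_deriv \<Omega> ds u g'"
  shows "AE x in lebesgue_on \<Omega>. g x = g' x"
proof -
  have gs: "locally_integrable \<Omega> g" "locally_integrable \<Omega> g'"
    using assms by (auto simp: has_weak_deriv_def)
  have "AE x in lebesgue_on \<Omega>. g x - g' x = 0"
  proof (rule fundamental_lemma_calculus_of_variations[OF \<open>open \<Omega>\<close>])
    show "locally_integrable \<Omega> (\<lambda>x. g x - g' x)"
      using gs by (auto simp: locally_integrable_def)
    fix \<phi> assume \<phi>: "\<phi> \<in> test_functions \<Omega>"
    then have "(- 1) ^ length ds * (LINT x|lebesgue_on \<Omega>. g x * \<phi> x)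
        = (- 1) ^ length ds * (LINT x|lebesgue_on \<Omega>. g' x * \<phi> x)"
      using assms(2,3) by (simp add: has_weak_deriv_def)
    then show "(LINT x|lebesgue_on \<Omega>. (g x - g' x) * \<phi> x) = 0"
      using integrable_mult_test_function[OF gs(1) \<phi> \<open>open \<Omega>\<close>]
        integrable_mult_test_function[OF gs(2) \<phi> \<open>open \<Omega>\<close>]
      by (simp add: left_diff_distrib)
  qed
  then show ?thesis by eventually_elim simp
qed

lemma locally_integrable_measurable:
  fixes g :: "real \<Rightarrow> real"
  assumes "open \<Omega>" and g: "locally_integrable \<Omega> g"
  shows "g \<in> borel_measurable (lebesgue_on \<Omega>)"
proof -
  obtain \<D> where \<D>: "countable \<D>" "\<D> \<subseteq> Pow \<Omega>" "\<And>X. X \<in> \<D> \<Longrightarrow> \<exists>a b. X = cbox a b" "\<Union>\<D> = \<Omega>"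
    using open_countable_Union_open_cbox[OF \<open>open \<Omega>\<close>] by metis
  have X: "compact X" "X \<subseteq> \<Omega>" if "X \<in> \<D>" for X
    using \<D>(2) \<D>(3)[OF that] that by (metis compact_cbox, auto)
  have \<Omega>: "\<Omega> \<in> sets lebesgue" using \<open>open \<Omega>\<close> by auto
  show ?thesis
  proof (rule measurable_piecewise_restrict[OF \<D>(1)])
    fix X assume "X \<in> \<D>"
    note X = X[OF this]
    have sets: "X \<in> sets lebesgue" using X(1) by (auto dest: compact_imp_closed)
    show "X \<inter> space (lebesgue_on \<Omega>) \<in> sets (lebesgue_on \<Omega>)"
      using X(2) sets \<Omega> by (auto simp: sets_restrict_space_iff)
    have "restrict_space (lebesgue_on \<Omega>) X = lebesgue_on X"
      using X(2) sets \<Omega> by (subst restrict_restrict_space) (auto simp: Int_absorb1)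
    then show "g \<in> borel_measurable (restrict_space (lebesgue_on \<Omega>) X)"
      using g X by (auto simp: locally_integrable_def)
  qed (use \<D>(4) in auto)
qed

text \<open>The constant \<open>weak_deriv\<close> selects an unspecified weak derivative. By uniqueness the selected one agrees
almost everywhere with any explicitly known weak derivative, so norms and energies can be computed
with the latter.\<close>
lemma integral_weak_deriv_square:
  fixes u g :: "real \<Rightarrow> real"
  assumes "open \<Omega>" "has_weak_deriv \<Omega> ds u g"
  shows "(LINT x|lebesgue_on \<Omega>. (weak_deriv \<Omega> ds u x)\<^sup>2) = (LINT x|lebesgue_on \<Omega>. (g x)\<^sup>2)"
proof -
  have wd: "has_weak_deriv \<Omega> ds u (weak_deriv \<Omega> ds u)"
    unfolding weak_deriv_def using assms(2) by (rule someI[where P = "has_weak_deriv \<Omega> ds u"])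
  have "AE x in lebesgue_on \<Omega>. (weak_deriv \<Omega> ds u x)\<^sup>2 = (g x)\<^sup>2"
    using has_weak_deriv_unique[OF \<open>open \<Omega>\<close> wd assms(2)] by eventually_elim simp
  moreover have "weak_deriv \<Omega> ds u \<in> borel_measurable (lebesgue_on \<Omega>)" "g \<in> borel_measurable (lebesgue_on \<Omega>)"
    using wd assms by (auto simp: has_weak_deriv_def intro: locally_integrable_measurable)
  ultimately show ?thesis
    by (intro integral_cong_AE) auto
qed

section \<open>The functional along smooth variations\<close>

lemma twice_diff_off_finite_add_scaled:
  assumes f: "twice_diff_off_finite f f1 f2" and g: "twice_diff_off_finite g g1 g2"
  shows "twice_diff_off_finite (\<lambda>x. f x + c * g x) (\<lambda>x. f1 x + c * g1 x) (\<lambda>x. f2 x + c * g2 x)"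
proof -
  obtain S where S: "finite S" "\<And>x. x \<notin> S \<Longrightarrow> (f1 has_real_derivative f2 x) (at x)"
    using f by (auto simp: twice_diff_off_finite_def)
  obtain T where T: "finite T" "\<And>x. x \<notin> T \<Longrightarrow> (g1 has_real_derivative g2 x) (at x)"
    using g by (auto simp: twice_diff_off_finite_def)
  have "\<exists>U. finite U \<and> (\<forall>x. x \<notin> U \<longrightarrow>
      ((\<lambda>x. f1 x + c * g1 x) has_real_derivative f2 x + c * g2 x) (at x))"
    using S T by (intro exI[of _ "S \<union> T"]) (auto intro!: DERIV_add DERIV_cmult)
  moreover have "locally_bounded_borel (\<lambda>x. f2 x + c * g2 x)"
    using twice_diff_off_finite_locally_bounded[OF f] twice_diff_off_finite_locally_bounded[OF g]
    by (intro locally_bounded_borel_add locally_bounded_borel_mult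
        locally_bounded_borel_continuous[of "\<lambda>_. c"]) auto
  ultimately show ?thesis
    using f g by (auto simp: twice_diff_off_finite_def intro!: DERIV_add DERIV_cmult continuous_intros)
qed

lemma twice_diff_off_finite_test_function:
  assumes "\<phi> \<in> test_functions \<Omega>"
  shows "twice_diff_off_finite \<phi> (partial_deriv 1 \<phi>) (partial_deriv 1 (partial_deriv 1 \<phi>))"
proof -
  note d1 = partial_deriv_test_function[OF assms]
  note d2 = partial_deriv_test_function[OF d1]
  show ?thesis
    unfolding twice_diff_off_finite_def
    using test_function_has_derivative[OF assms] test_function_has_derivative[OF d1]
      continuous_on_of_real_derivative[OF test_function_has_derivative[OF d1], of UNIV]
      locally_bounded_borel_continuous[OF continuous_on_of_real_derivative
        [OF test_function_has_derivative[OF d2]]]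
    by blast
qed

lemma AC_functional_twice_diff_off_finite:
  fixes f :: "real \<Rightarrow> real"
  assumes "twice_diff_off_finite f f1 f2" "open \<Omega>"
  shows "AC_functional f \<Omega> =
    (LINT x|lebesgue_on \<Omega>. (f2 x)\<^sup>2) + measure lebesgue {x \<in> \<Omega>. f x > 0}"
  unfolding AC_functional_def weak_laplacian_def
  using integral_weak_deriv_square[OF \<open>open \<Omega>\<close> twice_diff_off_finite_has_weak_deriv(2)[OF assms]]
  by simp

lemma H2_norm_zero:
  assumes "open (\<Omega> :: real set)"
  shows "H2_norm \<Omega> (\<lambda>x. 0) = 0"
proof -
  have zero: "twice_diff_off_finite (\<lambda>x. 0) (\<lambda>x. 0) (\<lambda>x. 0)"
    by (auto simp: twice_diff_off_finite_def intro: locally_bounded_borel_continuous)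
  show ?thesis
    using twice_diff_off_finite_has_weak_deriv[OF zero assms, THEN integral_weak_deriv_square[OF assms]]
    by (simp add: H2_norm_def)
qed

text \<open>A test function is approximated by itself. The distance is then the norm of the zero function, which
is \<open>0\<close> only because the weak derivatives selected for the zero function vanish almost everywhere.\<close>
lemma test_function_in_H2_0:
  fixes \<phi> :: "real \<Rightarrow> real"
  assumes "\<phi> \<in> test_functions \<Omega>" "open \<Omega>" "bounded \<Omega>"
  shows "\<phi> \<in> H2_0 \<Omega>"
  using twice_diff_off_finite_H2[OF twice_diff_off_finite_test_function[OF assms(1)] assms(2,3)] assms(1)
    H2_norm_zero[OF assms(2)]
  by (auto simp: H2_0_def intro!: bexI[of _ \<phi>])

section \<open>Lowering the energy of the half parabola\<close>

text \<open>The first derivative is the positive part of \<open>x\<close>, which has a corner at \<open>0\<close>, so the second derivative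
jumps from \<open>0\<close> to \<open>1\<close> there.\<close>
lemma half_parabola_twice_diff_off_finite:
  fixes u :: "real \<Rightarrow> real"
  assumes u_def: "\<And>x. u x = (if x > 0 then 1 / 2 * x\<^sup>2 else 0)"
  shows "twice_diff_off_finite u (max 0) (indicator {0<..})"
  unfolding twice_diff_off_finite_def
proof (intro conjI allI exI[of _ "{0}"] impI)
  fix x :: real
  consider "x > 0" | "x = 0" | "x < 0" by linarith
  then show "(u has_real_derivative max 0 x) (at x)"
  proof cases
    case 1
    have "((\<lambda>x. 1 / 2 * x\<^sup>2) has_real_derivative max 0 x) (at x)"
      using 1 by (auto intro!: derivative_eq_intros)
    then show ?thesis
      by (rule has_field_derivative_transform_within_open[where S = "{0<..}"])
        (use 1 in \<open>auto simp: u_def\<close>)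
  next
    case 2
    have "((\<lambda>h. max 0 h / 2) \<longlongrightarrow> max 0 0 / 2) (at (0::real))"
      by (intro tendsto_intros) simp
    moreover have "(\<lambda>h. (u (0 + h) - u 0) / h) = (\<lambda>h. max 0 h / 2)"
      by (auto simp: u_def power2_eq_square fun_eq_iff)
    ultimately show ?thesis unfolding DERIV_def 2 by simp
  next
    case 3
    have "((\<lambda>x. 0) has_real_derivative max 0 x) (at x)"
      using 3 by simp
    then show ?thesis
      by (rule has_field_derivative_transform_within_open[where S = "{..<0}"])
        (use 3 in \<open>auto simp: u_def\<close>)
  qed
next
  show "continuous_on UNIV (max (0::real))" by (intro continuous_intros)
  show "locally_bounded_borel (indicator {0<..})"
    unfolding locally_bounded_borel_def by (auto intro!: exI[of _ 1] simp: indicator_def)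
  fix x :: real
  assume "x \<notin> {0}"
  then consider "x > 0" | "x < 0" by fastforce
  then show "(max 0 has_real_derivative indicator {0<..} x) (at x)"
  proof cases
    case 1
    have "((\<lambda>x. x) has_real_derivative indicator {0<..} x) (at x)"
      using 1 by simp
    then show ?thesis
      by (rule has_field_derivative_transform_within_open[where S = "{0<..}"]) (use 1 in auto)
  next
    case 2
    have "((\<lambda>x. 0) has_real_derivative indicator {0<..} x) (at x)"
      using 2 by simp
    then show ?thesis
      by (rule has_field_derivative_transform_within_open[where S = "{..<0}"]) (use 2 in auto)
  qed
qed simp

text \<open>On the right half line \<open>\<phi>''\<close> integrates to \<open>\<phi>'(1) - \<phi>'(0)\<close>, and \<open>\<phi>'(1) = 0\<close> since the support is compact
in \<open>(-1,1)\<close>. This is the boundary term at the free boundary point that makes the first variation of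
the energy nonzero.\<close>
lemma integral_half_line_second_derivative:
  fixes \<phi> :: "real \<Rightarrow> real"
  assumes \<phi>: "\<phi> \<in> test_functions {-1<..<1}"
  shows "(LINT x|lebesgue_on {-1<..<1}. indicator {0<..} x * partial_deriv 1 (partial_deriv 1 \<phi>) x)
    = - partial_deriv 1 \<phi> 0"
proof -
  let ?\<phi>' = "partial_deriv 1 \<phi>" and ?\<phi>'' = "partial_deriv 1 (partial_deriv 1 \<phi>)"
  note d1 = partial_deriv_test_function[OF \<phi>]
  note d2 = partial_deriv_test_function[OF d1]
  have outside: "f x = 0" if "f \<in> test_functions {-1<..<1}" "x \<ge> 1" for f and x :: real
    using that closure_subset[of "{x. f x \<noteq> 0}"] by (auto simp: test_functions_def)
  let ?h = "\<lambda>x. indicator {0<..} x * ?\<phi>'' x"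
  have zero: "?h x = 0" if "x \<notin> {0<..<1}" for x
    using that outside[OF d2, of x] by (auto simp: indicator_def)
  have "(LINT x|lebesgue_on {-1<..<1}. ?h x) = (LINT x|lebesgue_on {0<..<1}. ?h x)"
    using zero by (intro lebesgue_on_superset) auto
  also have "\<dots> = (LINT x|lebesgue_on {0..1}. ?h x)"
    using zero by (intro lebesgue_on_superset(1)[symmetric]) auto
  also have "\<dots> = ?\<phi>' 1 - ?\<phi>' 0"
  proof (rule has_integral_unique)
    have "locally_bounded_borel (indicator {0<..})"
      by (rule twice_diff_off_finite_locally_bounded(3)[OF half_parabola_twice_diff_off_finite]) (rule refl)
    then have "locally_bounded_borel ?h"
      by (intro locally_bounded_borel_mult twice_diff_off_finite_locally_bounded(3)
          [OF twice_diff_off_finite_test_function[OF \<phi>]])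
    then show "(?h has_integral (LINT x|lebesgue_on {0..1}. ?h x)) {0..1}"
      by (intro has_integral_integral_lebesgue_on locally_bounded_borel_integrable) auto
    show "(?h has_integral ?\<phi>' 1 - ?\<phi>' 0) {0..1}"
    proof (rule fundamental_theorem_of_calculus_strong[of "{0}"])
      show "continuous_on {0..1} ?\<phi>'"
        by (rule continuous_on_of_real_derivative[OF test_function_has_derivative[OF d1]])
      show "(?\<phi>' has_vector_derivative ?h x) (at x)" if "x \<in> {0..1} - {0}" for x
        using that test_function_has_derivative[OF d1, of x]
        by (simp add: has_real_derivative_iff_has_vector_derivative)
    qed auto
  qed
  also have "?\<phi>' 1 = 0" using outside[OF d1] by simp
  finally show ?thesis by simp
qed

text \<open>The direction of the variation. The factor \<open>x\<close> gives it a positive slope at \<open>0\<close> and makes it nonpositive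
on the left half line, where adding it must not create new points of positivity.\<close>
definition odd_bump :: "real \<Rightarrow> real" where
  "odd_bump x = x * bump (- 1 / 2) (1 / 2) 1 x"

lemma scaled_odd_bump_test_function: "(\<lambda>x. c * odd_bump x) \<in> test_functions {-1<..<1}"
proof (rule flat_algebra_test_function[where a = "- 1 / 2" and b = "1 / 2"])
  show "(\<lambda>x. c * odd_bump x) \<in> flat_algebra"
    unfolding odd_bump_def by (intro flat_algebra.mult flat_algebra.const flat_algebra.ident bump_in_flat_algebra)
qed (auto simp: odd_bump_def bump_eq)

lemma odd_bump_derivative_0: "partial_deriv 1 odd_bump 0 > 0"
proof -
  obtain d where "\<forall>x. (bump (- 1 / 2) (1 / 2) 1 has_real_derivative d x) (at x)"
    using flat_algebra_derivative bump_in_flat_algebra by blast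
  then have "(odd_bump has_real_derivative 1 * bump (- 1 / 2) (1 / 2) 1 0 + d 0 * 0) (at 0)"
    unfolding odd_bump_def[abs_def] by (intro DERIV_mult) auto
  moreover have "(odd_bump has_real_derivative partial_deriv 1 odd_bump 0) (at 0)"
    using scaled_odd_bump_test_function[of 1] by (intro test_function_has_derivative) simp
  ultimately have "partial_deriv 1 odd_bump 0 = bump (- 1 / 2) (1 / 2) 1 0"
    using DERIV_unique by fastforce
  also have "\<dots> > 0" by (simp add: bump_eq)
  finally show ?thesis .
qed

text \<open>Expanding the square of \<open>u'' + c \<phi>''\<close> yields a linear term \<open>2 c\<close> times the integral of \<open>\<phi>''\<close> over the
positive half line, which is \<open>-\<phi>'(0)\<close>, and a quadratic term. The measure term does not increase:
for \<open>x \<le> 0\<close> the function \<open>u + c \<phi>\<close> is nonpositive, so it is positive only where \<open>u\<close> is.\<close>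
lemma AC_functional_half_parabola_variation:
  fixes u :: "real \<Rightarrow> real"
  assumes u_def: "\<And>x. u x = (if x > 0 then 1 / 2 * x\<^sup>2 else 0)" and "c \<ge> 0"
  defines "\<Omega> \<equiv> {-1<..<1::real}"
  shows "AC_functional (\<lambda>x. u x + c * odd_bump x) \<Omega> \<le> AC_functional u \<Omega>
    - 2 * c * partial_deriv 1 odd_bump 0
    + c\<^sup>2 * (LINT x|lebesgue_on \<Omega>. (partial_deriv 1 (partial_deriv 1 odd_bump) x)\<^sup>2)"
proof -
  let ?H = "indicator {0<..} :: real \<Rightarrow> real" and ?\<phi>'' = "partial_deriv 1 (partial_deriv 1 odd_bump)"
  let ?v = "\<lambda>x. u x + c * odd_bump x"
  have \<phi>: "odd_bump \<in> test_functions \<Omega>"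
    using scaled_odd_bump_test_function[of 1] by (simp add: \<Omega>_def)
  note u = half_parabola_twice_diff_off_finite[OF u_def]
  note \<phi>2 = twice_diff_off_finite_test_function[OF \<phi>]
  note v = twice_diff_off_finite_add_scaled[OF u \<phi>2, of c]
  have \<Omega>: "open \<Omega>" "bounded \<Omega>" "\<Omega> \<in> sets lebesgue" by (auto simp: \<Omega>_def)
  have int: "integrable (lebesgue_on \<Omega>) (\<lambda>x. f x * g x)"
    if "locally_bounded_borel f" "locally_bounded_borel g" for f g
    using that \<Omega> by (intro locally_bounded_borel_integrable locally_bounded_borel_mult)
  have ints: "integrable (lebesgue_on \<Omega>) (\<lambda>x. (?H x)\<^sup>2)"
    "integrable (lebesgue_on \<Omega>) (\<lambda>x. ?H x * ?\<phi>'' x)"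
    "integrable (lebesgue_on \<Omega>) (\<lambda>x. (?\<phi>'' x)\<^sup>2)"
    using twice_diff_off_finite_locally_bounded(3)[OF u] twice_diff_off_finite_locally_bounded(3)[OF \<phi>2]
    by (auto simp: power2_eq_square int simp del: indicator_simps)
  have "(LINT x|lebesgue_on \<Omega>. (?H x + c * ?\<phi>'' x)\<^sup>2)
      = (LINT x|lebesgue_on \<Omega>. (?H x)\<^sup>2 + (2 * c) * (?H x * ?\<phi>'' x) + c\<^sup>2 * (?\<phi>'' x)\<^sup>2)"
    by (intro Bochner_Integration.integral_cong) (auto simp: power2_eq_square algebra_simps)
  also have "\<dots> = (LINT x|lebesgue_on \<Omega>. (?H x)\<^sup>2)
      + (2 * c) * (LINT x|lebesgue_on \<Omega>. ?H x * ?\<phi>'' x)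
      + c\<^sup>2 * (LINT x|lebesgue_on \<Omega>. (?\<phi>'' x)\<^sup>2)"
    using ints by simp
  also have "(LINT x|lebesgue_on \<Omega>. ?H x * ?\<phi>'' x) = - partial_deriv 1 odd_bump 0"
    using integral_half_line_second_derivative \<phi> unfolding \<Omega>_def by blast
  finally have energy: "(LINT x|lebesgue_on \<Omega>. (?H x + c * ?\<phi>'' x)\<^sup>2)
      = (LINT x|lebesgue_on \<Omega>. (?H x)\<^sup>2) - 2 * c * partial_deriv 1 odd_bump 0
        + c\<^sup>2 * (LINT x|lebesgue_on \<Omega>. (?\<phi>'' x)\<^sup>2)"
    by simp
  have "measure lebesgue {x \<in> \<Omega>. ?v x > 0} \<le> measure lebesgue {x \<in> \<Omega>. u x > 0}"
  proof (rule measure_mono_fmeasurable)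
    have "u x > 0" if "?v x > 0" for x
    proof (rule ccontr)
      assume "\<not> u x > 0"
      then have "\<not> x > 0" by (auto simp: u_def)
      then have "odd_bump x \<le> 0"
        by (auto simp: odd_bump_def bump_bounds mult_nonpos_nonneg)
      then have "c * odd_bump x \<le> 0" using \<open>c \<ge> 0\<close> by (simp add: mult_nonneg_nonpos)
      then show False using that \<open>\<not> x > 0\<close> by (simp add: u_def)
    qed
    then show "{x \<in> \<Omega>. ?v x > 0} \<subseteq> {x \<in> \<Omega>. u x > 0}"
      by blast
    have "continuous_on UNIV ?v"
      by (rule continuous_on_of_real_derivative) (use v in \<open>auto simp: twice_diff_off_finite_def\<close>)
    then have "open (\<Omega> \<inter> {x. 0 < ?v x})"
      using \<Omega>(1) by (intro open_Int open_Collect_less continuous_on_const)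
    then show "{x \<in> \<Omega>. ?v x > 0} \<in> sets lebesgue"
      by (simp add: Int_def)
    have "{x \<in> \<Omega>. u x > 0} = {0<..<1}" by (auto simp: u_def \<Omega>_def)
    then show "{x \<in> \<Omega>. u x > 0} \<in> lmeasurable" by simp
  qed
  then show ?thesis
    using energy AC_functional_twice_diff_off_finite[OF u \<Omega>(1)] AC_functional_twice_diff_off_finite[OF v \<Omega>(1)]
    by simp
qed

theorem lemma8:
  fixes u :: "real \<Rightarrow> real"
  assumes u_def: "\<And>x. u x = (if x > 0 then 1 / 2 * x\<^sup>2 else 0)"
  shows "u \<in> H2_loc \<and> \<not> global_minimizer u \<and>
    (\<exists>v \<in> H2 {-1<..<1}. (\<lambda>x. v x - u x) \<in> H2_0 {-1<..<1} \<and>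
       AC_functional v {-1<..<1} < AC_functional u {-1<..<1})"
proof -
  note u = half_parabola_twice_diff_off_finite[OF u_def]
  define p where "p = partial_deriv 1 odd_bump 0"
  define C where "C = (LINT x|lebesgue_on {-1<..<1}. (partial_deriv 1 (partial_deriv 1 odd_bump) x)\<^sup>2)"
  \<comment> \<open>The gain \<open>2 c p\<close> has to beat \<open>c\<^sup>2 C\<close>; the summand \<open>1\<close> avoids a case distinction on \<open>C = 0\<close>.\<close>
  define c where "c = p / (C + 1)"
  define v where "v = (\<lambda>x. u x + c * odd_bump x)"
  have "p > 0" unfolding p_def by (rule odd_bump_derivative_0)
  moreover have "C \<ge> 0" unfolding C_def by simp
  ultimately have "c > 0" and cC: "c * (C + 1) = p" by (auto simp: c_def)
  have "v \<in> H2 {-1<..<1}"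
    unfolding v_def using scaled_odd_bump_test_function[of 1]
    by (intro twice_diff_off_finite_H2[OF twice_diff_off_finite_add_scaled[OF u twice_diff_off_finite_test_function]]) auto
  moreover have "(\<lambda>x. v x - u x) \<in> H2_0 {-1<..<1}"
    unfolding v_def using test_function_in_H2_0[OF scaled_odd_bump_test_function] by simp
  moreover have "AC_functional v {-1<..<1} < AC_functional u {-1<..<1}"
  proof -
    have "c * (c * C) < c * (2 * p)"
    proof (rule mult_strict_left_mono[OF _ \<open>c > 0\<close>])
      show "c * C < 2 * p" using cC \<open>c > 0\<close> \<open>p > 0\<close> by (simp add: distrib_left)
    qed
    then have "c\<^sup>2 * C < 2 * c * p" by (simp add: power2_eq_square mult_ac)
    moreover have "AC_functional v {-1<..<1} \<le> AC_functional u {-1<..<1} - 2 * c * p + c\<^sup>2 * C"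
      unfolding v_def p_def C_def
      using AC_functional_half_parabola_variation[OF u_def, of c] \<open>c > 0\<close> by simp
    ultimately show ?thesis by linarith
  qed
  moreover have "u \<in> H2_loc"
    using twice_diff_off_finite_H2[OF u] by (auto simp: H2_loc_def)
  moreover have "open {-1<..<1::real}" "bounded {-1<..<1::real}" by auto
  ultimately show ?thesis
    unfolding global_minimizer_def by (meson not_less)
qed

end
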